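(* Let $n\ge 1$ be an integer, let $\kappa\in\mathbb{R}$ with $\kappa\neq 0$, and let $p_1,\dots,p_{n+2}\in M_\kappa^n$. Let $d_{ij}:=d_{M_\kappa^n}(p_i,p_j)$ and $$\gamma_\kappa(p_1,\dots,p_{n+2}):=\det\big(s_\kappa^2(d_{ij}/2)\big)_{1\le i,j\le n+2}.$$ Then $\gamma_\kappa(p_1,\dots,p_{n+2})$ either vanishes or has sign $(-1)^{n+1}$.
   Context: For $x,y\in\mathbb{R}^{n+1}$ let $\langle x,y\rangle=x_0y_0+\dots+x_ny_n$ and $\langle x|y\rangle=-x_0y_0+x_1y_1+\dots+x_ny_n$. The model space of constant curvature $\kappa\ne 0$ is $M_\kappa^n=\{x\in\mathbb{R}^{n+1}:\langle x,x\rangle=1/\kappa\}$ with distance $d_{M_\kappa^n}(x,y)=\frac{1}{\sqrt{\kappa}}\arccos(\kappa\langle x,y\rangle)$ if $\kappa>0$, and $M_\kappa^n=\{x\in\mathbb{R}^{n+1}:\langle x|x\rangle=1/\kappa,\ x_0>0\}$ with distance $d_{M_\kappa^n}(x,y)=\frac{1}{\sqrt{-\kappa}}\operatorname{arcosh}(\kappa\langle x|y\rangle)$ if $\kappa<0$. The function $s_\kappa:[0,\infty)\to\mathbb{R}$ is $s_\kappa(t)=\frac{1}{\sqrt{\kappa}}\sin(\sqrt{\kappa}\,t)$ if $\kappa>0$ and $s_\kappa(t)=\frac{1}{\sqrt{-\kappa}}\sinh(\sqrt{-\kappa}\,t)$ if $\kappa<0$; $s_\kappa^2(t)$ denotes $(s_\kappa(t))^2$.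 *)

theory Defs
  imports Complex_Main "Jordan_Normal_Form.Determinant"
begin

text \<open>Vectors of $\mathbb{R}^{n+1}$ are real vectors of dimension \<open>n + 1\<close> with
  coordinates \<open>x $ 0, \<dots>, x $ n\<close>; the standard inner product is \<open>x \<bullet> y\<close>.\<close>

definition lorentz_prod :: "real vec \<Rightarrow> real vec \<Rightarrow> real" where
  "lorentz_prod x y = - (x $ 0 * y $ 0) + (\<Sum>i = 1..<dim_vec y. x $ i * y $ i)"

text \<open>In the next three definitions only \<open>\<kappa> \<noteq> 0\<close> is meaningful: the \<open>else\<close> branches are
  intended for \<open>\<kappa> < 0\<close>.\<close>

definition model_space :: "real \<Rightarrow> nat \<Rightarrow> real vec set" where
  "model_space \<kappa> n =
    (if \<kappa> > 0 then {x \<in> carrier_vec (n + 1). x \<bullet> x = 1 / \<kappa>}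
     else {x \<in> carrier_vec (n + 1). lorentz_prod x x = 1 / \<kappa> \<and> x $ 0 > 0})"

definition model_dist :: "real \<Rightarrow> real vec \<Rightarrow> real vec \<Rightarrow> real" where
  "model_dist \<kappa> x y =
    (if \<kappa> > 0 then 1 / sqrt \<kappa> * arccos (\<kappa> * (x \<bullet> y))
     else 1 / sqrt (- \<kappa>) * arcosh (\<kappa> * lorentz_prod x y))"

definition s_fun :: "real \<Rightarrow> real \<Rightarrow> real" where
  "s_fun \<kappa> t =
    (if \<kappa> > 0 then 1 / sqrt \<kappa> * sin (sqrt \<kappa> * t)
     else 1 / sqrt (- \<kappa>) * sinh (sqrt (- \<kappa>) * t))"

text \<open>The points are indexed by \<open>0, \<dots>, n + 1\<close>, following the 0-based indexing of matrices.\<close>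

definition gamma_det :: "real \<Rightarrow> nat \<Rightarrow> (nat \<Rightarrow> real vec) \<Rightarrow> real" where
  "gamma_det \<kappa> n p =
    det (mat (n + 2) (n + 2) (\<lambda>(i, j). (s_fun \<kappa> (model_dist \<kappa> (p i) (p j) / 2))\<^sup>2))"

end

theory Submission
  imports Defs "HOL-Analysis.L2_Norm"
begin

text \<open>Let \<open>B\<close> be the bilinear form defining the model space. The half-angle formulas give
  $s_\kappa^2(d_{ij}/2) = \frac12(1/\kappa - B(p_i,p_j))$, so the matrix factors as
  $Q D Q^T$, where row \<open>i\<close> of the square matrix \<open>Q\<close> is $(1, p_i)$ and \<open>D\<close> is
  diagonal with entry $1/(2\kappa)$ followed by the coefficients of $-\frac12 B$.
  Its determinant is $(\det Q)^2 \det D$, and $\det D$ has sign $(-1)^{n+1}$ whatever the sign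
  of \<open>\<kappa>\<close>, because the first entry and the time coordinate change sign together.\<close>

lemma Cauchy_Schwarz_sum_L2_set:
  fixes f g :: "'a \<Rightarrow> real"
  shows "\<bar>\<Sum>i\<in>A. f i * g i\<bar> \<le> L2_set f A * L2_set g A"
proof -
  have "\<bar>\<Sum>i\<in>A. f i * g i\<bar> \<le> (\<Sum>i\<in>A. \<bar>f i\<bar> * \<bar>g i\<bar>)"
    using sum_abs[of "\<lambda>i. f i * g i" A] by (simp add: abs_mult)
  then show ?thesis
    using L2_set_mult_ineq[of f g A] by linarith
qed

lemma L2_set_squared: "(L2_set f A)\<^sup>2 = (\<Sum>i\<in>A. (f i)\<^sup>2)"
  by (simp add: L2_set_def sum_nonneg)

definition model_form :: "real \<Rightarrow> real vec \<Rightarrow> real vec \<Rightarrow> real" where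
  "model_form \<kappa> x y = (if \<kappa> > 0 then x \<bullet> y else lorentz_prod x y)"

text \<open>Splitting off coordinate 0 lets one formula serve both signs of \<kappa>: the two forms
  differ only in the coefficient \<open>sgn \<kappa>\<close> of that coordinate.\<close>

lemma model_form_eq_sum:
  assumes "\<kappa> \<noteq> 0" and "y \<in> carrier_vec (n + 1)"
  shows "model_form \<kappa> x y = sgn \<kappa> * (x $ 0 * y $ 0) + (\<Sum>k<n. x $ Suc k * y $ Suc k)"
proof -
  have "(\<Sum>k = 1..<Suc n. x $ k * y $ k) = (\<Sum>k<n. x $ Suc k * y $ Suc k)"
    using sum.shift_bounds_Suc_ivl[of "\<lambda>k. x $ k * y $ k" 0 n]
    by (simp add: atLeast0LessThan)
  moreover have "(\<Sum>k = 0..<Suc n. x $ k * y $ k)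
      = x $ 0 * y $ 0 + (\<Sum>k = 1..<Suc n. x $ k * y $ k)"
    by (simp add: sum.atLeast_Suc_lessThan)
  moreover have "dim_vec y = Suc n"
    using assms(2) by auto
  ultimately show ?thesis
    using assms(1) by (simp add: model_form_def lorentz_prod_def scalar_prod_def sgn_if)
qed

text \<open>Cauchy-Schwarz for two vectors of norm \<open>1 / sqrt \<kappa>\<close>. It places the
  argument of \<open>arccos\<close> in [-1, 1], where \<open>cos\<close> undoes it.\<close>

lemma model_form_pos_bound:
  assumes "\<kappa> > 0" and x: "x \<in> model_space \<kappa> n" and y: "y \<in> model_space \<kappa> n"
  shows "\<bar>\<kappa> * model_form \<kappa> x y\<bar> \<le> 1"
proof -
  have d: "dim_vec x = n + 1" "dim_vec y = n + 1"
    and xx: "x \<bullet> x = 1 / \<kappa>" and yy: "y \<bullet> y = 1 / \<kappa>"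
    using assms by (auto simp: model_space_def)
  let ?L = "\<lambda>v. L2_set (($) v) {0..<n + 1}"
  have "?L x = 1 / sqrt \<kappa>" "?L y = 1 / sqrt \<kappa>"
    using xx yy d by (simp_all add: L2_set_def scalar_prod_def power2_eq_square real_sqrt_divide)
  then have "?L x * ?L y = 1 / \<kappa>"
    using \<open>\<kappa> > 0\<close> by simp
  then have "\<bar>model_form \<kappa> x y\<bar> \<le> 1 / \<kappa>"
    using Cauchy_Schwarz_sum_L2_set[of "($) x" "($) y" "{0..<n + 1}"] d \<open>\<kappa> > 0\<close>
    by (simp add: model_form_def scalar_prod_def)
  then show ?thesis
    using \<open>\<kappa> > 0\<close> by (simp add: abs_mult field_simps)
qed

text \<open>Reversed Cauchy-Schwarz inequality on the upper sheet of the hyperboloid. It places the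
  argument of \<open>arcosh\<close> where \<open>cosh\<close> undoes it.\<close>

lemma model_form_neg_bound:
  assumes "\<kappa> < 0" and x: "x \<in> model_space \<kappa> n" and y: "y \<in> model_space \<kappa> n"
  shows "\<kappa> * model_form \<kappa> x y \<ge> 1"
proof -
  have cx: "x \<in> carrier_vec (n + 1)" and cy: "y \<in> carrier_vec (n + 1)"
    and x0: "x $ 0 > 0" and y0: "y $ 0 > 0"
    and "model_form \<kappa> x x = 1 / \<kappa>" "model_form \<kappa> y y = 1 / \<kappa>"
    using assms by (auto simp: model_space_def model_form_def)
  define a where "a = L2_set (\<lambda>k. x $ Suc k) {..<n}"
  define b where "b = L2_set (\<lambda>k. y $ Suc k) {..<n}"
  define r where "r = - (1 / \<kappa>)"
  have r: "r > 0"
    using \<open>\<kappa> < 0\<close> by (simp add: r_def)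
  have "a\<^sup>2 = (\<Sum>k<n. x $ Suc k * x $ Suc k)" "b\<^sup>2 = (\<Sum>k<n. y $ Suc k * y $ Suc k)"
    unfolding a_def b_def L2_set_squared by (simp_all add: power2_eq_square)
  then have xx: "(x $ 0)\<^sup>2 = r + a\<^sup>2" and yy: "(y $ 0)\<^sup>2 = r + b\<^sup>2"
    using model_form_eq_sum[OF _ cx, of \<kappa> x] model_form_eq_sum[OF _ cy, of \<kappa> y]
      \<open>model_form \<kappa> x x = 1 / \<kappa>\<close> \<open>model_form \<kappa> y y = 1 / \<kappa>\<close> \<open>\<kappa> < 0\<close>
    by (simp_all add: r_def power2_eq_square[of "x $ 0"] power2_eq_square[of "y $ 0"])
  \<comment> \<open>The term added is the exact gap: (r + a^2)(r + b^2) - (r + ab)^2 = r (a -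
    b)^2.\<close>
  have "(r + a * b)\<^sup>2 \<le> (r + a * b)\<^sup>2 + r * (a - b)\<^sup>2"
    using r by simp
  also have "\<dots> = (x $ 0 * y $ 0)\<^sup>2"
    unfolding power_mult_distrib xx yy by (simp add: power2_eq_square algebra_simps)
  \<comment> \<open>Dropping the squares uses that both points lie on the sheet with positive
    coordinate 0.\<close>
  finally have "r + a * b \<le> x $ 0 * y $ 0"
    by (rule power2_le_imp_le) (use x0 y0 in simp)
  \<comment> \<open>Ordinary Cauchy-Schwarz on the spatial coordinates.\<close>
  moreover have "model_form \<kappa> x y \<le> a * b - x $ 0 * y $ 0"
    using model_form_eq_sum[OF _ cy, of \<kappa> x] \<open>\<kappa> < 0\<close>
      Cauchy_Schwarz_sum_L2_set[of "\<lambda>k. x $ Suc k" "\<lambda>k. y $ Suc k" "{..<n}"]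
    by (simp add: a_def b_def)
  ultimately have "model_form \<kappa> x y \<le> 1 / \<kappa>"
    by (simp add: r_def)
  then show ?thesis
    using \<open>\<kappa> < 0\<close> by (simp add: field_simps)
qed

text \<open>Half-angle formulas cos t = 1 - 2 sin^2(t/2) and cosh t = 1 + 2 sinh^2(t/2), applied to
  the rescaled distance \<open>t\<close>. For negative \<kappa>, dividing by -\<kappa> restores the
  same right-hand side.\<close>

lemma s_fun_half_model_dist_squared:
  assumes "\<kappa> \<noteq> 0" and x: "x \<in> model_space \<kappa> n" and y: "y \<in> model_space \<kappa> n"
  shows "(s_fun \<kappa> (model_dist \<kappa> x y / 2))\<^sup>2 = (1 / \<kappa> - model_form \<kappa> x y) / 2"
proof (cases "\<kappa> > 0")
  case True
  define t where "t = arccos (\<kappa> * model_form \<kappa> x y)"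
  have "cos t = \<kappa> * model_form \<kappa> x y"
    using model_form_pos_bound[OF True x y] by (simp add: t_def cos_arccos abs_le_iff)
  then have "(sin (t / 2))\<^sup>2 = (1 - \<kappa> * model_form \<kappa> x y) / 2"
    using cos_double_sin[of "t / 2"] by simp
  moreover have "s_fun \<kappa> (model_dist \<kappa> x y / 2) = sin (t / 2) / sqrt \<kappa>"
    using True by (simp add: s_fun_def model_dist_def model_form_def t_def)
  ultimately show ?thesis
    using True by (simp add: power_divide diff_divide_distrib)
next
  case False
  then have neg: "\<kappa> < 0"
    using assms(1) by simp
  define t where "t = arcosh (\<kappa> * model_form \<kappa> x y)"
  have "cosh t = \<kappa> * model_form \<kappa> x y"
    using model_form_neg_bound[OF neg x y] by (simp add: t_def)
  then have "(sinh (t / 2))\<^sup>2 = (\<kappa> * model_form \<kappa> x y - 1) / 2"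
    using cosh_double[of "t / 2"] by (simp add: cosh_square_eq)
  moreover have "s_fun \<kappa> (model_dist \<kappa> x y / 2) = sinh (t / 2) / sqrt (- \<kappa>)"
    using neg by (simp add: s_fun_def model_dist_def model_form_def t_def)
  ultimately show ?thesis
    using neg by (simp add: power_divide diff_divide_distrib)
qed

lemma det_mult_mat_diag_transpose:
  fixes A :: "'a :: comm_ring_1 mat"
  assumes A: "A \<in> carrier_mat n n"
  shows "det (A * mat_diag n d * A\<^sup>T) = (det A)\<^sup>2 * (\<Prod>k<n. d k)"
proof -
  have "det (mat_diag n d) = (\<Prod>k<n. d k)"
    by (subst det_upper_triangular[of _ n])
      (auto simp: upper_triangular_def mat_diag_def prod_list_diag_prod atLeast0LessThan)
  then show ?thesis
    using A by (simp add: det_mult[of _ n] det_transpose power2_eq_square mult_ac)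
qed

theorem theorem3:
  fixes n :: nat and \<kappa> :: real and p :: "nat \<Rightarrow> real vec"
  assumes "n \<ge> 1" and "\<kappa> \<noteq> 0"
    and "\<And>i. i < n + 2 \<Longrightarrow> p i \<in> model_space \<kappa> n"
  shows "gamma_det \<kappa> n p = 0 \<or> sgn (gamma_det \<kappa> n p) = (-1) ^ (n + 1)"
proof -
  \<comment> \<open>The extra column of ones makes \<open>Q\<close> square, with n + 2 points and n
    + 1 coordinates, and produces the constant term 1/\<kappa>. Column \<open>k > 0\<close> holds
    coordinate \<open>k - 1\<close>, so \<open>d 1\<close> below weights coordinate 0.\<close>
  define Q where "Q = mat (n + 2) (n + 2) (\<lambda>(i, k). if k = 0 then 1 else p i $ (k - 1))"
  define d where "d k = (if k = 0 then 1 / \<kappa> else if k = 1 then - sgn \<kappa> else - 1) / 2"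
    for k :: nat
  have Q: "Q \<in> carrier_mat (n + 2) (n + 2)"
    by (simp add: Q_def)
  have "mat (n + 2) (n + 2) (\<lambda>(i, j). (s_fun \<kappa> (model_dist \<kappa> (p i) (p j) / 2))\<^sup>2)
      = Q * mat_diag (n + 2) d * Q\<^sup>T" (is "?G = _")
  proof (rule eq_matI)
    fix i j assume "i < dim_row (Q * mat_diag (n + 2) d * Q\<^sup>T)"
      and "j < dim_col (Q * mat_diag (n + 2) d * Q\<^sup>T)"
    then have i: "i < n + 2" and j: "j < n + 2"
      using Q by auto
    have "p j \<in> carrier_vec (n + 1)"
      using assms(3)[OF j] by (auto simp: model_space_def split: if_splits)
    then have "?G $$ (i, j)
        = (1 / \<kappa> - (sgn \<kappa> * (p i $ 0 * p j $ 0) + (\<Sum>k<n. p i $ Suc k * p j $ Suc k))) / 2"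
      using s_fun_half_model_dist_squared[OF assms(2) assms(3)[OF i] assms(3)[OF j]]
        model_form_eq_sum[OF assms(2), of "p j" n "p i"] i j by simp
    \<comment> \<open>Peeling off the indices 0 and 1 isolates the constant term and the
      coordinate-0 term.\<close>
    also have "\<dots> = (\<Sum>k<Suc (Suc n). Q $$ (i, k) * d k * Q $$ (j, k))"
      unfolding sum.lessThan_Suc_shift using i j
      by (simp add: Q_def d_def sum_negf sum_divide_distrib diff_divide_distrib add_divide_distrib)
    also have "\<dots> = (\<Sum>k<n + 2. Q $$ (i, k) * d k * Q $$ (j, k))"
      by (simp only: add_2_eq_Suc')
    also have "\<dots> = (Q * mat_diag (n + 2) d * Q\<^sup>T) $$ (i, j)"
      unfolding mat_diag_mult_right[OF Q] using i j Q
      by (simp add: scalar_prod_def atLeast0LessThan del: sum.lessThan_Suc add_2_eq_Suc')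
    finally show "?G $$ (i, j) = (Q * mat_diag (n + 2) d * Q\<^sup>T) $$ (i, j)" .
  qed (use Q in auto)
  then have gamma: "gamma_det \<kappa> n p = (det Q)\<^sup>2 * (\<Prod>k<n + 2. d k)"
    using det_mult_mat_diag_transpose[OF Q] by (simp add: gamma_det_def)
  have "(\<Prod>k<n + 2. d k) = 1 / \<kappa> / 2 * (- sgn \<kappa> / 2) * (- 1 / 2) ^ n"
    unfolding add_2_eq_Suc' prod.lessThan_Suc_shift by (simp add: d_def)
  \<comment> \<open>Here \<open>sgn \<kappa> / \<kappa>\<close> becomes
    \<open>1 / \<bar>\<kappa>\<bar>\<close>, and the n + 1 minus signs of the form entries are
    collected.\<close>
  also have "\<dots> = (- 1) ^ (n + 1) * (1 / (\<bar>\<kappa>\<bar> * 2 ^ (n + 2)))"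
    using assms(2) power_minus[of "1 / 2 :: real" n] by (simp add: sgn_if abs_if power_divide)
  finally have "sgn (\<Prod>k<n + 2. d k) = sgn ((- 1) ^ (n + 1)) * sgn (1 / (\<bar>\<kappa>\<bar> * 2 ^ (n + 2)))"
    by (simp only: sgn_mult)
  also have "\<dots> = (- 1) ^ (n + 1)"
    using assms(2) by (cases "even n") simp_all
  finally have "sgn (\<Prod>k<n + 2. d k) = (- 1) ^ (n + 1)" .
  moreover have "det Q = 0 \<or> sgn ((det Q)\<^sup>2) = 1"
    using sgn_pos[of "(det Q)\<^sup>2"] by auto
  ultimately show ?thesis
    unfolding gamma sgn_mult by auto
qed

end
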